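(* Fix constants $k_0>0$ and $b_0>0$ independent of $N$, and for $N\in\mathbb{N}$ put $\rho_0=\frac{N}{2\pi}$, $a_0^2=\frac{k_0}{\rho_0^2}$. Consider the eigenvalue problem for the linear PDE $$\left(\frac{\partial^2}{\partial t^2}+b_0\frac{\partial}{\partial t}-a_0^2\frac{\partial^2}{\partial x^2}\right)v=0,\qquad x\in[0,2\pi],$$ with either Dirichlet boundary conditions $v(0,t)=v(2\pi,t)=0$ or Neumann-Dirichlet boundary conditions $\frac{\partial v}{\partial x}(0,t)=v(2\pi,t)=0$. The least stable eigenvalue, denoted by $s_1^+$, satisfies $$s_1^+=-\frac{\pi^2k_0}{b_0}\frac1{N^2}+O\!\left(\frac1{N^4}\right)\quad\text{(Dirichlet-Dirichlet)},$$ $$s_1^+=-\frac{\pi^2k_0}{4b_0}\frac1{N^2}+O\!\left(\frac1{N^4}\right)\quad\text{(Neumann-Dirichlet)},$$ as $N\to\infty$.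
   Context: The PDE is the continuum model of the velocity perturbations of an $N$-vehicle platoon under symmetric bidirectional control (equal constant front and back gains $k_0$, velocity gain $b_0$). Eigenvalues: $s\in\mathbb{C}$ is an eigenvalue of the PDE if there is a nonzero $\eta$ satisfying the boundary conditions with $s^2\eta+b_0s\eta-a_0^2\eta''=0$; equivalently $s^2+b_0s-a_0^2\lambda=0$ for some eigenvalue $\lambda$ of $\eta''=\lambda\eta$ with these boundary conditions. The eigenvalues $\lambda$ are ordered $0>\lambda_1>\lambda_2>\cdots$, and $s_l^{\pm}=\frac{-b_0\pm\sqrt{b_0^2+4a_0^2\lambda_l}}{2}$. The least stable eigenvalue is $s_1^+$ (real for large $N$). *)

theory Defs
  imports Complex_Main "HOL-Library.Landau_Symbols"
begin

datatype boundary_condition = Dirichlet_Dirichlet | Neumann_Dirichlet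

text \<open>Boundary conditions on \<open>[0, 2\<pi>]\<close> for a mode with values \<open>\<eta>\<close> and derivative \<open>\<eta>'\<close>;
  the Neumann end is \<open>x = 0\<close>.\<close>

fun satisfies_bc :: "boundary_condition \<Rightarrow> (real \<Rightarrow> complex) \<Rightarrow> (real \<Rightarrow> complex) \<Rightarrow> bool" where
  "satisfies_bc Dirichlet_Dirichlet \<eta> \<eta>' \<longleftrightarrow> \<eta> 0 = 0 \<and> \<eta> (2 * pi) = 0"
| "satisfies_bc Neumann_Dirichlet \<eta> \<eta>' \<longleftrightarrow> \<eta>' 0 = 0 \<and> \<eta> (2 * pi) = 0"

text \<open>Only values on \<open>[0, 2\<pi>]\<close> matter; \<open>at x within\<close> makes the derivatives one-sided at the end
  points, and \<open>\<eta>''\<close> is the second derivative of \<open>\<eta>\<close>.\<close>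

definition nonzero_mode ::
    "boundary_condition \<Rightarrow> (real \<Rightarrow> complex) \<Rightarrow> (real \<Rightarrow> complex) \<Rightarrow> bool" where
  "nonzero_mode bc \<eta> \<eta>'' \<longleftrightarrow>
     (\<exists>x\<in>{0..2 * pi}. \<eta> x \<noteq> 0) \<and>
     (\<exists>\<eta>'. satisfies_bc bc \<eta> \<eta>' \<and>
       (\<forall>x\<in>{0..2 * pi}.
          (\<eta> has_vector_derivative \<eta>' x) (at x within {0..2 * pi}) \<and>
          (\<eta>' has_vector_derivative \<eta>'' x) (at x within {0..2 * pi})))"

definition laplace_eigenvalue :: "boundary_condition \<Rightarrow> complex \<Rightarrow> bool" where
  "laplace_eigenvalue bc \<mu> \<longleftrightarrow>
     (\<exists>\<eta> \<eta>''. nonzero_mode bc \<eta> \<eta>'' \<and> (\<forall>x\<in>{0..2 * pi}. \<eta>'' x = \<mu> * \<eta> x))"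

text \<open>The first element \<open>\<lambda>\<^sub>1\<close> in the ordering \<open>0 > \<lambda>\<^sub>1 > \<lambda>\<^sub>2 > \<dots>\<close>, i.e. the largest eigenvalue
  of \<open>\<eta>'' = \<mu> \<eta>\<close>.\<close>

definition lambda1 :: "boundary_condition \<Rightarrow> real" where
  "lambda1 bc = (GREATEST \<mu>. laplace_eigenvalue bc (complex_of_real \<mu>))"

definition rho0 :: "nat \<Rightarrow> real" where
  "rho0 N = real N / (2 * pi)"

definition a0_sq :: "real \<Rightarrow> nat \<Rightarrow> real" where
  "a0_sq k0 N = k0 / (rho0 N)\<^sup>2"

definition pde_eigenvalue :: "boundary_condition \<Rightarrow> real \<Rightarrow> real \<Rightarrow> nat \<Rightarrow> complex \<Rightarrow> bool" where
  "pde_eigenvalue bc k0 b0 N s \<longleftrightarrow>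
     (\<exists>\<eta> \<eta>''. nonzero_mode bc \<eta> \<eta>'' \<and>
       (\<forall>x\<in>{0..2 * pi}.
          s\<^sup>2 * \<eta> x + of_real b0 * s * \<eta> x - of_real (a0_sq k0 N) * \<eta>'' x = 0))"

definition least_stable :: "boundary_condition \<Rightarrow> real \<Rightarrow> real \<Rightarrow> nat \<Rightarrow> complex \<Rightarrow> bool" where
  "least_stable bc k0 b0 N s \<longleftrightarrow>
     pde_eigenvalue bc k0 b0 N s \<and> (\<forall>s'. pde_eigenvalue bc k0 b0 N s' \<longrightarrow> Re s' \<le> Re s)"

text \<open>The root \<open>s\<^sub>1\<^sup>+\<close> of \<open>s\<^sup>2 + b\<^sub>0 s - a\<^sub>0\<^sup>2 \<lambda>\<^sub>1 = 0\<close>. The complex square root is needed because the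
  discriminant can be negative for small \<open>N\<close>.\<close>

definition s1_plus :: "boundary_condition \<Rightarrow> real \<Rightarrow> real \<Rightarrow> nat \<Rightarrow> complex" where
  "s1_plus bc k0 b0 N =
     (- of_real b0 + csqrt (of_real (b0\<^sup>2 + 4 * a0_sq k0 N * lambda1 bc))) / 2"

end

theory Submission
  imports Defs "HOL-Analysis.Complex_Transcendental"
begin

text \<open>
  The problem splits into a spectral part and a quadratic equation. After division by
  \<open>a\<^sub>0\<^sup>2\<close> a number \<open>s\<close> is an eigenvalue of the PDE iff
  \<open>(s\<^sup>2 + b\<^sub>0 s) / a\<^sub>0\<^sup>2\<close> is an eigenvalue of \<open>\<eta>'' = \<mu> \<eta>\<close>
  (\<open>pde_eigenvalue_iff_laplace\<close>).

  The spectral part must exclude every complex \<open>\<mu>\<close> outside the expected list. Writing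
  \<open>\<mu> = - w\<^sup>2\<close> with complex \<open>w\<close>, the solution rotates with frequency \<open>w\<close>, and undoing this
  rotation of the pair \<open>(\<eta>', w \<eta>)\<close> gives two quantities that are constant in \<open>x\<close>
  (\<open>first_integrals\<close>). They play two roles: comparing the end points turns the boundary
  conditions into \<open>sin (2 \<pi> w) = 0\<close> or \<open>cos (2 \<pi> w) = 0\<close>, and their invertibility replaces
  the uniqueness theorem for the initial value problem. The zeros of the complex sine and
  cosine are real, so \<open>w\<close> is a nonzero multiple of \<open>1/2\<close>, or an odd multiple of \<open>1/4\<close>;
  hence \<open>\<mu>\<close> is real and \<open>\<lambda>\<^sub>1 = - \<kappa>\<^sup>2\<close> with \<open>\<kappa> = 1/2\<close> or \<open>\<kappa> = 1/4\<close>
  (\<open>laplace_eigenvalue_le\<close>, \<open>lambda1_eq\<close>).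

  Now consider \<open>s\<^sup>2 + b\<^sub>0 s = c\<close> with real \<open>c \<le> a\<^sub>0\<^sup>2 \<lambda>\<^sub>1\<close>. Since
  \<open>a\<^sub>0\<^sup>2 = 4 \<pi>\<^sup>2 k\<^sub>0 / N\<^sup>2\<close> tends to \<open>0\<close>, the discriminant of the first mode is positive for
  large \<open>N\<close>. Every real root is then at most \<open>s\<^sub>1\<^sup>+\<close>, with equality only at \<open>s\<^sub>1\<^sup>+\<close> itself, while
  nonreal roots have real part \<open>- b\<^sub>0 / 2 < s\<^sub>1\<^sup>+\<close> (\<open>damped_root_le\<close>). With
  \<open>u = - a\<^sub>0\<^sup>2 \<lambda>\<^sub>1 = 4 \<pi>\<^sup>2 k\<^sub>0 \<kappa>\<^sup>2 / N\<^sup>2\<close> the root is \<open>- u / b\<^sub>0\<close> up to an error of at most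
  \<open>4 u\<^sup>2 / b\<^sub>0\<^sup>3\<close> (\<open>damped_root_expansion\<close>), which is of order \<open>1 / N\<^sup>4\<close>.
\<close>

section \<open>Eigenvalues of the second derivative\<close>

lemma has_vector_derivative_sin_scaled:
  fixes w :: complex
  shows "((\<lambda>x. sin (w * of_real x)) has_vector_derivative w * cos (w * of_real x)) (at x within S)"
  by (rule has_vector_derivative_real_field) (auto intro!: derivative_eq_intros)

lemma has_vector_derivative_cos_scaled:
  fixes w :: complex
  shows "((\<lambda>x. cos (w * of_real x)) has_vector_derivative - (w * sin (w * of_real x))) (at x within S)"
  by (rule has_vector_derivative_real_field) (auto intro!: derivative_eq_intros)

lemma constant_if_zero_vector_derivative:
  fixes f :: "real \<Rightarrow> complex"
  assumes "\<And>x. x \<in> {0..L} \<Longrightarrow> (f has_vector_derivative 0) (at x within {0..L})"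
    and "x \<in> {0..L}"
  shows "f x = f 0"
proof -
  obtain c where "\<And>y. y \<in> {0..L} \<Longrightarrow> f y = c"
    using has_vector_derivative_zero_constant[of "{0..L}" f] assms(1) by auto
  with assms(2) show ?thesis by auto
qed

text \<open>
  The equation says that \<open>(\<eta>', w \<eta>)\<close> solves the first-order system of a rotation with angular
  speed \<open>w\<close>; the two left-hand sides are this vector rotated back by the angle \<open>w x\<close>. Since
  \<open>w\<close> may be any complex number, no realness of the eigenvalue is presupposed.
\<close>

lemma first_integrals:
  fixes w :: complex and \<eta> \<eta>' :: "real \<Rightarrow> complex"
  assumes d0: "\<And>x. x \<in> {0..L} \<Longrightarrow> (\<eta> has_vector_derivative \<eta>' x) (at x within {0..L})"
    and d1: "\<And>x. x \<in> {0..L} \<Longrightarrow> (\<eta>' has_vector_derivative - w\<^sup>2 * \<eta> x) (at x within {0..L})"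
    and x: "x \<in> {0..L}"
  shows "\<eta>' x * cos (w * of_real x) + w * \<eta> x * sin (w * of_real x) = \<eta>' 0"
    and "\<eta>' x * sin (w * of_real x) - w * \<eta> x * cos (w * of_real x) = - w * \<eta> 0"
proof -
  note d = d0 d1 has_vector_derivative_sin_scaled has_vector_derivative_cos_scaled
    has_vector_derivative_mult has_vector_derivative_add has_vector_derivative_diff
    has_vector_derivative_const
  have "((\<lambda>x. \<eta>' x * cos (w * of_real x) + w * \<eta> x * sin (w * of_real x))
          has_vector_derivative 0) (at x within {0..L})" if "x \<in> {0..L}" for x
    by (rule has_vector_derivative_eq_rhs, (rule d that)+)
       (simp add: algebra_simps power2_eq_square)
  from constant_if_zero_vector_derivative[OF this x]
  show "\<eta>' x * cos (w * of_real x) + w * \<eta> x * sin (w * of_real x) = \<eta>' 0" by simp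
  have "((\<lambda>x. \<eta>' x * sin (w * of_real x) - w * \<eta> x * cos (w * of_real x))
          has_vector_derivative 0) (at x within {0..L})" if "x \<in> {0..L}" for x
    by (rule has_vector_derivative_eq_rhs, (rule d that)+)
       (simp add: algebra_simps power2_eq_square)
  from constant_if_zero_vector_derivative[OF this x]
  show "\<eta>' x * sin (w * of_real x) - w * \<eta> x * cos (w * of_real x) = - w * \<eta> 0" by simp
qed

text \<open>
  For \<open>w = 0\<close> the first integrals no longer contain \<open>\<eta>\<close>, so the eigenvalue \<open>0\<close> has to be
  excluded by solving \<open>\<eta>'' = 0\<close>.
\<close>

lemma affine_if_zero_second_derivative:
  fixes \<eta> \<eta>' :: "real \<Rightarrow> complex"
  assumes d0: "\<And>x. x \<in> {0..L} \<Longrightarrow> (\<eta> has_vector_derivative \<eta>' x) (at x within {0..L})"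
    and d1: "\<And>x. x \<in> {0..L} \<Longrightarrow> (\<eta>' has_vector_derivative 0) (at x within {0..L})"
    and x: "x \<in> {0..L}"
  shows "\<eta> x = \<eta> 0 + of_real x * \<eta>' 0"
proof -
  have c: "\<eta>' y = \<eta>' 0" if "y \<in> {0..L}" for y
    using constant_if_zero_vector_derivative[OF d1 that] by simp
  have "((\<lambda>x. \<eta> x - of_real x * \<eta>' 0) has_vector_derivative 0) (at y within {0..L})"
    if "y \<in> {0..L}" for y
  proof -
    have "((\<lambda>x. of_real x * \<eta>' 0) has_vector_derivative \<eta>' 0) (at y within {0..L})"
      by (rule has_vector_derivative_real_field) (auto intro!: derivative_eq_intros)
    from has_vector_derivative_diff[OF d0[OF that] this] show ?thesis by (simp add: c[OF that])
  qed
  from constant_if_zero_vector_derivative[OF this x] show ?thesis by (simp add: algebra_simps)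
qed

text \<open>
  The slowest modes are \<open>sin (x / 2)\<close> and \<open>cos (x / 4)\<close>: half, respectively a quarter, of a
  wavelength fits into \<open>[0, 2\<pi>]\<close>.
\<close>

fun fundamental_frequency :: "boundary_condition \<Rightarrow> real" where
  "fundamental_frequency Dirichlet_Dirichlet = 1 / 2"
| "fundamental_frequency Neumann_Dirichlet = 1 / 4"

text \<open>
  Both boundary conditions give \<open>\<eta> (2\<pi>) = 0\<close>, and the condition at \<open>0\<close> makes one of the two
  first integrals vanish. Evaluated at \<open>2\<pi>\<close>, that integral is \<open>\<eta>' (2\<pi>)\<close> times a sine or a
  cosine. The factor \<open>\<eta>' (2\<pi>)\<close> is nonzero, because zero Cauchy data at \<open>2\<pi>\<close> would force
  \<open>\<eta> = 0\<close>. So \<open>w\<close> is a zero of the sine or cosine of \<open>2 \<pi> w\<close>.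
\<close>

lemma laplace_eigenvalue_le:
  assumes "laplace_eigenvalue bc \<mu>"
  shows "\<exists>r. \<mu> = complex_of_real r \<and> r \<le> - (fundamental_frequency bc)\<^sup>2"
proof -
  define L :: real where "L = 2 * pi"
  have L: "0 \<in> {0..L}" "L \<in> {0..L}" "L \<noteq> 0" by (auto simp: L_def)
  from assms obtain \<eta> \<eta>' \<eta>'' x0 where x0: "x0 \<in> {0..L}" "\<eta> x0 \<noteq> 0"
    and bc: "satisfies_bc bc \<eta> \<eta>'"
    and d0: "\<And>x. x \<in> {0..L} \<Longrightarrow> (\<eta> has_vector_derivative \<eta>' x) (at x within {0..L})"
    and d1: "\<And>x. x \<in> {0..L} \<Longrightarrow> (\<eta>' has_vector_derivative \<eta>'' x) (at x within {0..L})"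
    and ev: "\<And>x. x \<in> {0..L} \<Longrightarrow> \<eta>'' x = \<mu> * \<eta> x"
    unfolding laplace_eigenvalue_def nonzero_mode_def L_def by blast
  define w where "w = csqrt (- \<mu>)"
  have \<mu>: "\<mu> = - w\<^sup>2" by (simp add: w_def)
  have d2: "(\<eta>' has_vector_derivative - w\<^sup>2 * \<eta> x) (at x within {0..L})" if "x \<in> {0..L}" for x
    using d1[OF that] ev[OF that] \<mu> by simp
  have fi: "\<eta>' x * cos (w * of_real x) + w * \<eta> x * sin (w * of_real x) = \<eta>' 0"
    "\<eta>' x * sin (w * of_real x) - w * \<eta> x * cos (w * of_real x) = - w * \<eta> 0"
    if "x \<in> {0..L}" for x
    by (rule first_integrals, erule d0, erule d2, rule that)+
  have \<eta>L: "\<eta> L = 0" using bc by (cases bc) (auto simp: L_def)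
  have w0: "w \<noteq> 0"
  proof
    assume "w = 0"
    then have affine: "\<eta> x = \<eta> 0 + of_real x * \<eta>' 0" if "x \<in> {0..L}" for x
      using d2 by (intro affine_if_zero_second_derivative[OF _ _ that] d0) simp_all
    have "\<eta> 0 = 0 \<and> \<eta>' 0 = 0"
      using bc affine[OF L(2)] \<eta>L L(3) by (cases bc) auto
    then show False using affine[OF x0(1)] x0(2) by simp
  qed
  have \<eta>'L: "\<eta>' L \<noteq> 0"
  proof
    assume z: "\<eta>' L = 0"
    have "\<eta>' 0 = 0" "w * \<eta> 0 = 0" using fi[OF L(2)] z \<eta>L by auto
    then have c: "\<eta>' x0 * cos (w * of_real x0) + w * \<eta> x0 * sin (w * of_real x0) = 0"
      and s: "\<eta>' x0 * sin (w * of_real x0) - w * \<eta> x0 * cos (w * of_real x0) = 0"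
      using fi[OF x0(1)] by auto
    \<comment> \<open>Rotating forward again recovers \<open>w \<eta>\<close> from the two vanishing first integrals.\<close>
    have "w * \<eta> x0 * ((sin (w * of_real x0))\<^sup>2 + (cos (w * of_real x0))\<^sup>2) = 0"
      using c s by algebra
    then show False using w0 x0(2) by simp
  qed
  show ?thesis
  proof (cases bc)
    case Dirichlet_Dirichlet
    then have "sin (w * of_real L) = 0"
      using fi(2)[OF L(2)] bc \<eta>L \<eta>'L by simp
    then obtain n :: int where "w * of_real L = of_real (n * pi)"
      by (auto simp: sin_eq_0)
    then have wn: "w = of_real (real_of_int n / 2)"
      by (simp add: L_def field_simps)
    with w0 have "n \<noteq> 0" by auto
    then have "1 \<le> n\<^sup>2" by (simp add: int_one_le_iff_zero_less)
    then have "1 \<le> (real_of_int n)\<^sup>2" by (metis of_int_1_le_iff of_int_power)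
    then have "- (real_of_int n / 2)\<^sup>2 \<le> - (fundamental_frequency bc)\<^sup>2"
      using Dirichlet_Dirichlet by (simp add: power_divide)
    moreover have "\<mu> = of_real (- (real_of_int n / 2)\<^sup>2)" by (simp add: \<mu> wn)
    ultimately show ?thesis by blast
  next
    case Neumann_Dirichlet
    then have "cos (w * of_real L) = 0"
      using fi(1)[OF L(2)] bc \<eta>L \<eta>'L by simp
    then obtain n :: int where "w * of_real L = of_real (n * pi) + of_real pi / 2"
      by (auto simp: cos_eq_0)
    then have "of_real pi * (4 * w) = complex_of_real pi * (2 * of_int n + 1)"
      by (simp add: L_def field_simps)
    then have "4 * w = 2 * of_int n + 1" by (subst (asm) mult_cancel_left) simp
    then have wn: "w = of_real (real_of_int (2 * n + 1) / 4)"
      by (simp add: field_simps)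
    have "2 * n + 1 \<noteq> 0" by presburger
    then have "1 \<le> (2 * n + 1)\<^sup>2" by (simp add: int_one_le_iff_zero_less del: power2_sum)
    then have "1 \<le> (real_of_int (2 * n + 1))\<^sup>2" by (metis of_int_1_le_iff of_int_power)
    then have "- (real_of_int (2 * n + 1) / 4)\<^sup>2 \<le> - (fundamental_frequency bc)\<^sup>2"
      using Neumann_Dirichlet by (simp add: power_divide)
    moreover have "\<mu> = of_real (- (real_of_int (2 * n + 1) / 4)\<^sup>2)" by (simp add: \<mu> wn)
    ultimately show ?thesis by blast
  qed
qed

lemma laplace_eigenvalue_fundamental:
  "laplace_eigenvalue bc (complex_of_real (- (fundamental_frequency bc)\<^sup>2))"
proof -
  note d = has_vector_derivative_sin_scaled has_vector_derivative_cos_scaled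
    has_vector_derivative_mult has_vector_derivative_const has_vector_derivative_minus
  show ?thesis
  proof (cases bc)
    case Dirichlet_Dirichlet
    define w :: complex where "w = 1 / 2"
    have "nonzero_mode bc (\<lambda>x. sin (w * of_real x)) (\<lambda>x. - w\<^sup>2 * sin (w * of_real x))"
      unfolding nonzero_mode_def
    proof (intro conjI exI[of _ "\<lambda>x. w * cos (w * of_real x)"] ballI)
      have "w * of_real pi = of_real (pi / 2)" by (simp add: w_def)
      then have "sin (w * of_real pi) = 1" by (simp only: sin_of_real) simp
      then show "\<exists>x\<in>{0..2 * pi}. sin (w * of_real x) \<noteq> 0"
        by (intro bexI[of _ pi]) auto
      show "satisfies_bc bc (\<lambda>x. sin (w * of_real x)) (\<lambda>x. w * cos (w * of_real x))"
        using Dirichlet_Dirichlet by (simp add: w_def)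
    next
      fix x :: real
      show "((\<lambda>x. w * cos (w * of_real x)) has_vector_derivative - w\<^sup>2 * sin (w * of_real x))
          (at x within {0..2 * pi})"
        by (rule has_vector_derivative_eq_rhs, (rule d)+) (simp add: power2_eq_square)
    qed (rule d)
    moreover have "complex_of_real (- (fundamental_frequency bc)\<^sup>2) = - w\<^sup>2"
      using Dirichlet_Dirichlet by (simp add: w_def)
    ultimately show ?thesis unfolding laplace_eigenvalue_def by force
  next
    case Neumann_Dirichlet
    define w :: complex where "w = 1 / 4"
    have "nonzero_mode bc (\<lambda>x. cos (w * of_real x)) (\<lambda>x. - w\<^sup>2 * cos (w * of_real x))"
      unfolding nonzero_mode_def
    proof (intro conjI exI[of _ "\<lambda>x. - (w * sin (w * of_real x))"] ballI)
      show "\<exists>x\<in>{0..2 * pi}. cos (w * of_real x) \<noteq> 0"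
        by (intro bexI[of _ 0]) auto
      have "w * of_real (2 * pi) = of_real (pi / 2)" by (simp add: w_def)
      then have "cos (w * of_real (2 * pi)) = 0" by (simp only: cos_of_real) simp
      then show "satisfies_bc bc (\<lambda>x. cos (w * of_real x)) (\<lambda>x. - (w * sin (w * of_real x)))"
        using Neumann_Dirichlet by simp
    next
      fix x :: real
      show "((\<lambda>x. - (w * sin (w * of_real x))) has_vector_derivative - w\<^sup>2 * cos (w * of_real x))
          (at x within {0..2 * pi})"
        by (rule has_vector_derivative_eq_rhs, (rule d)+) (simp add: power2_eq_square)
    qed (rule d)
    moreover have "complex_of_real (- (fundamental_frequency bc)\<^sup>2) = - w\<^sup>2"
      using Neumann_Dirichlet by (simp add: w_def)
    ultimately show ?thesis unfolding laplace_eigenvalue_def by force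
  qed
qed

lemma lambda1_eq: "lambda1 bc = - (fundamental_frequency bc)\<^sup>2"
  unfolding lambda1_def
proof (rule Greatest_equality)
  show "laplace_eigenvalue bc (complex_of_real (- (fundamental_frequency bc)\<^sup>2))"
    by (rule laplace_eigenvalue_fundamental)
next
  fix r assume "laplace_eigenvalue bc (complex_of_real r)"
  from laplace_eigenvalue_le[OF this] show "r \<le> - (fundamental_frequency bc)\<^sup>2" by auto
qed

section \<open>From the Laplacian to the damped wave equation\<close>

lemma pde_eigenvalue_iff_laplace:
  assumes "a0_sq k0 N \<noteq> 0"
  shows "pde_eigenvalue bc k0 b0 N s \<longleftrightarrow>
    laplace_eigenvalue bc ((s\<^sup>2 + of_real b0 * s) / of_real (a0_sq k0 N))"
proof -
  have "s\<^sup>2 * y + of_real b0 * s * y - of_real (a0_sq k0 N) * z = 0 \<longleftrightarrow>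
      z = (s\<^sup>2 + of_real b0 * s) / of_real (a0_sq k0 N) * y" for y z
    using assms by (auto simp: field_simps)
  then show ?thesis unfolding pde_eigenvalue_def laplace_eigenvalue_def by simp
qed

text \<open>
  The imaginary part of the equation reads \<open>Im s * (2 * Re s + b) = 0\<close>. Hence a root is either
  real, and then the larger root is increasing in \<open>c\<close>, or it lies on the line
  \<open>Re s = - b / 2\<close>, strictly to the left of \<open>t\<close> because the discriminant at \<open>r\<close> is positive.
  The strict alternative yields that the least stable eigenvalue is unique.
\<close>

lemma damped_root_le:
  fixes b c r :: real and s :: complex
  assumes "c \<le> r" "b\<^sup>2 + 4 * r > 0"
    and s: "s\<^sup>2 + of_real b * s = of_real c"
  defines "t \<equiv> (- b + sqrt (b\<^sup>2 + 4 * r)) / 2"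
  shows "s = of_real t \<or> Re s < t"
proof -
  have re: "(Re s)\<^sup>2 - (Im s)\<^sup>2 + b * Re s = c" and im: "Im s * (2 * Re s + b) = 0"
    using arg_cong[OF s, of Re] arg_cong[OF s, of Im]
    by (auto simp: power2_eq_square algebra_simps)
  from im have "Re s = - b / 2 \<or> Im s = 0" by auto
  then consider "Re s = - b / 2" | "Im s = 0" by blast
  then show ?thesis
  proof cases
    case 1
    then show ?thesis using assms(2) by (simp add: t_def field_simps)
  next
    case 2
    have "(2 * Re s + b)\<^sup>2 \<le> b\<^sup>2 + 4 * r"
      using re 2 assms(1) by (simp add: power2_eq_square algebra_simps)
    then have "2 * Re s + b \<le> sqrt (b\<^sup>2 + 4 * r)" by (rule real_le_rsqrt)
    then have "Re s \<le> t" by (simp add: t_def field_simps)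
    then show ?thesis using 2 by (auto simp: complex_eq_iff)
  qed
qed

lemma s1_plus_real:
  assumes "b0\<^sup>2 + 4 * a0_sq k0 N * lambda1 bc \<ge> 0"
  shows "s1_plus bc k0 b0 N =
    of_real ((- b0 + sqrt (b0\<^sup>2 + 4 * a0_sq k0 N * lambda1 bc)) / 2)"
  unfolding s1_plus_def using assms by (subst csqrt_of_real_nonneg) auto

lemma least_stable_iff_s1_plus:
  assumes a: "a0_sq k0 N > 0"
    and D: "b0\<^sup>2 + 4 * a0_sq k0 N * lambda1 bc > 0"
  shows "least_stable bc k0 b0 N s \<longleftrightarrow> s = s1_plus bc k0 b0 N"
proof -
  define t where "t = (- b0 + sqrt (b0\<^sup>2 + 4 * a0_sq k0 N * lambda1 bc)) / 2"
  have s1: "s1_plus bc k0 b0 N = of_real t" using s1_plus_real D by (simp add: t_def)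
  have "t\<^sup>2 + b0 * t = a0_sq k0 N * lambda1 bc"
  proof -
    have "2 * t + b0 = sqrt (b0\<^sup>2 + 4 * a0_sq k0 N * lambda1 bc)"
      by (simp add: t_def field_simps)
    then have "(2 * t + b0)\<^sup>2 = b0\<^sup>2 + 4 * a0_sq k0 N * lambda1 bc" using D by simp
    then show ?thesis by (simp add: power2_eq_square algebra_simps)
  qed
  then have "(complex_of_real t)\<^sup>2 + of_real b0 * of_real t = of_real (a0_sq k0 N * lambda1 bc)"
    by (metis of_real_add of_real_mult of_real_power)
  then have ev: "pde_eigenvalue bc k0 b0 N (of_real t)"
    using laplace_eigenvalue_fundamental[of bc] a
    by (simp add: pde_eigenvalue_iff_laplace lambda1_eq)
  have dom: "s' = of_real t \<or> Re s' < t" if s': "pde_eigenvalue bc k0 b0 N s'" for s'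
  proof -
    from s' a laplace_eigenvalue_le obtain r where
      "(s'\<^sup>2 + of_real b0 * s') / of_real (a0_sq k0 N) = complex_of_real r" and r: "r \<le> lambda1 bc"
      by (metis pde_eigenvalue_iff_laplace lambda1_eq less_irrefl)
    then have "s'\<^sup>2 + of_real b0 * s' = of_real (a0_sq k0 N * r)"
      using a by (simp add: field_simps)
    then show ?thesis
      using damped_root_le[where b = b0 and c = "a0_sq k0 N * r" and r = "a0_sq k0 N * lambda1 bc" and s = s'] a D r
      by (simp add: t_def mult.assoc)
  qed
  show ?thesis
    unfolding least_stable_def s1 using ev dom by fastforce
qed

section \<open>Large platoons\<close>

lemma a0_sq_eq: "a0_sq k0 N = 4 * pi\<^sup>2 * k0 / (real N)\<^sup>2"
  by (simp add: a0_sq_def rho0_def power_divide power_mult_distrib field_simps)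

lemma discriminant_eventually_pos:
  assumes "b0 > 0"
  shows "\<forall>\<^sub>F N in sequentially. b0\<^sup>2 + 4 * a0_sq k0 N * lambda1 bc > 0"
proof -
  have "(\<lambda>N. b0\<^sup>2 + 4 * (4 * pi\<^sup>2 * k0 * inverse (real N) ^ 2) * lambda1 bc)
      \<longlonglongrightarrow> b0\<^sup>2 + 4 * (4 * pi\<^sup>2 * k0 * 0 ^ 2) * lambda1 bc"
    by (intro tendsto_intros lim_inverse_n)
  then have "(\<lambda>N. b0\<^sup>2 + 4 * a0_sq k0 N * lambda1 bc) \<longlonglongrightarrow> b0\<^sup>2"
    by (simp add: a0_sq_eq divide_inverse power_inverse)
  then show ?thesis by (rule order_tendstoD) (use assms in simp)
qed

text \<open>
  Let \<open>q = sqrt (b\<^sup>2 - 4 u)\<close>. The left-hand side equals \<open>(b - q)\<^sup>2 / (4 b)\<close>, and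
  \<open>b - q = 4 u / (b + q)\<close> with \<open>b + q \<ge> b\<close>; so the error is quadratic in \<open>u\<close> uniformly up to
  the point where the discriminant vanishes.
\<close>

lemma damped_root_expansion:
  fixes b u :: real
  assumes b: "b > 0" and D: "b\<^sup>2 - 4 * u \<ge> 0"
  shows "\<bar>(- b + sqrt (b\<^sup>2 - 4 * u)) / 2 + u / b\<bar> \<le> 4 * u\<^sup>2 / b ^ 3"
proof -
  define q where "q = sqrt (b\<^sup>2 - 4 * u)"
  have q: "q \<ge> 0" "u = (b\<^sup>2 - q\<^sup>2) / 4" using D by (auto simp: q_def)
  have "(- b + q) / 2 + u / b = - ((b - q)\<^sup>2 / (4 * b))"
    using b by (simp add: q(2) field_simps power2_eq_square)
  moreover have "1 \<le> ((b + q) / b)\<^sup>2" using b q(1) by (intro one_le_power) simp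
  then have "(b - q)\<^sup>2 / (4 * b) * 1 \<le> (b - q)\<^sup>2 / (4 * b) * ((b + q) / b)\<^sup>2"
    using b by (intro mult_left_mono) simp_all
  moreover have "(b - q)\<^sup>2 / (4 * b) * ((b + q) / b)\<^sup>2 = 4 * u\<^sup>2 / b ^ 3"
    using b by (simp add: q(2) field_simps power2_eq_square power3_eq_cube)
  moreover have "(b - q)\<^sup>2 / (4 * b) \<ge> 0" using b by simp
  ultimately show ?thesis by (simp add: q_def)
qed

lemma s1_plus_expansion:
  assumes b: "b0 > 0"
  shows "(\<lambda>N. s1_plus bc k0 b0 N - complex_of_real
            (- (4 * (fundamental_frequency bc)\<^sup>2 * pi\<^sup>2 * k0 / b0) * (1 / real N ^ 2)))
         \<in> O(\<lambda>N. complex_of_real (1 / real N ^ 4))"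
proof (rule bigoI)
  define c where "c = 4 * (fundamental_frequency bc)\<^sup>2 * pi\<^sup>2 * k0"
  show "\<forall>\<^sub>F N in sequentially. norm (s1_plus bc k0 b0 N - complex_of_real
            (- (4 * (fundamental_frequency bc)\<^sup>2 * pi\<^sup>2 * k0 / b0) * (1 / real N ^ 2)))
          \<le> (4 * c\<^sup>2 / b0 ^ 3) * norm (complex_of_real (1 / real N ^ 4))"
    using discriminant_eventually_pos[OF b, of k0 bc]
  proof eventually_elim
    case (elim N)
    define u where "u = c / (real N)\<^sup>2"
    have D: "b0\<^sup>2 + 4 * a0_sq k0 N * lambda1 bc = b0\<^sup>2 - 4 * u"
      by (simp add: u_def c_def a0_sq_eq lambda1_eq)
    have "- (4 * (fundamental_frequency bc)\<^sup>2 * pi\<^sup>2 * k0 / b0) * (1 / real N ^ 2) = - (u / b0)"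
      by (simp add: u_def c_def)
    moreover have "s1_plus bc k0 b0 N = of_real ((- b0 + sqrt (b0\<^sup>2 - 4 * u)) / 2)"
      using s1_plus_real[of b0 k0 N bc] elim unfolding D by simp
    ultimately have "s1_plus bc k0 b0 N - complex_of_real
            (- (4 * (fundamental_frequency bc)\<^sup>2 * pi\<^sup>2 * k0 / b0) * (1 / real N ^ 2))
        = of_real ((- b0 + sqrt (b0\<^sup>2 - 4 * u)) / 2 + u / b0)"
      by simp
    moreover have "\<bar>(- b0 + sqrt (b0\<^sup>2 - 4 * u)) / 2 + u / b0\<bar> \<le> 4 * u\<^sup>2 / b0 ^ 3"
      using elim unfolding D by (intro damped_root_expansion[OF b]) simp
    moreover have "4 * u\<^sup>2 / b0 ^ 3 = (4 * c\<^sup>2 / b0 ^ 3) * norm (complex_of_real (1 / real N ^ 4))"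
      by (simp add: u_def power_divide norm_divide norm_power)
    ultimately show ?case by (metis norm_of_real)
  qed
qed

theorem corollary1:
  fixes k0 b0 :: real
  assumes "k0 > 0" and "b0 > 0"
  shows "(\<forall>bc. \<forall>\<^sub>F N in sequentially.
           s1_plus bc k0 b0 N \<in> \<real> \<and>
           (\<forall>s. least_stable bc k0 b0 N s \<longleftrightarrow> s = s1_plus bc k0 b0 N)) \<and>
         (\<lambda>N. s1_plus Dirichlet_Dirichlet k0 b0 N
              - complex_of_real (- (pi\<^sup>2 * k0 / b0) * (1 / real N ^ 2)))
           \<in> O(\<lambda>N. complex_of_real (1 / real N ^ 4)) \<and>
         (\<lambda>N. s1_plus Neumann_Dirichlet k0 b0 N
              - complex_of_real (- (pi\<^sup>2 * k0 / (4 * b0)) * (1 / real N ^ 2)))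
           \<in> O(\<lambda>N. complex_of_real (1 / real N ^ 4))"
proof (intro conjI allI)
  fix bc
  show "\<forall>\<^sub>F N in sequentially. s1_plus bc k0 b0 N \<in> \<real> \<and>
           (\<forall>s. least_stable bc k0 b0 N s \<longleftrightarrow> s = s1_plus bc k0 b0 N)"
    using discriminant_eventually_pos[OF assms(2), of k0 bc] eventually_gt_at_top[of 0]
  proof eventually_elim
    case (elim N)
    then have "a0_sq k0 N > 0" using assms(1) by (simp add: a0_sq_eq)
    then show ?case
      using least_stable_iff_s1_plus[OF _ elim(1)] s1_plus_real[OF less_imp_le[OF elim(1)]]
      by (metis Reals_of_real)
  qed
next
  show "(\<lambda>N. s1_plus Dirichlet_Dirichlet k0 b0 N
            - complex_of_real (- (pi\<^sup>2 * k0 / b0) * (1 / real N ^ 2)))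
         \<in> O(\<lambda>N. complex_of_real (1 / real N ^ 4))"
    using s1_plus_expansion[OF assms(2), of Dirichlet_Dirichlet k0] by (simp add: power_divide)
  show "(\<lambda>N. s1_plus Neumann_Dirichlet k0 b0 N
            - complex_of_real (- (pi\<^sup>2 * k0 / (4 * b0)) * (1 / real N ^ 2)))
         \<in> O(\<lambda>N. complex_of_real (1 / real N ^ 4))"
    using s1_plus_expansion[OF assms(2), of Neumann_Dirichlet k0] by (simp add: power_divide)
qed

end
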